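(* Let $n,i,j$ be integers with $i$ odd and $0\le j<i<n$, and for each $N\ge0$ let $D^N_1$ be the $(N+1)\times(N+1)$ matrix defined in the context. Then $$(D^{n+1}_1)_{n-i+1,\,n-j+1}+k^1_{n,i,j}\,(D^n_1)_{n-i,\,n-j}+k^2_{n,i,j}\,(D^{n-1}_1)_{n-i-1,\,n-j-1}=0,$$ where $$k^1_{n,i,j}= h\left(\left(cd(a-b)-\frac{b(e-a)(f-a)(g-a)}{a-b-1}\right)\frac{1+a-b}{a(e-b)(f-b)(g-b)}-1\right),$$ $$k^2_{n,i,j}= l\,\frac{b(e-a)(f-a)(g-a)(1+a-b)}{(a-b-1)\,a(e-b)(f-b)(g-b)},$$ with $$a=n+\tfrac{3-j}{2},\quad b=-n+\tfrac{i+j}{2},\quad c=-\tfrac j2,\quad d=\tfrac{j-i+1}{2},\quad e=1,\quad f=\tfrac12,\quad g=\tfrac32,$$ $$h=\frac{\sqrt{2(n-i)+3}\,\sqrt{2(n-j)+3}\,(2n-i-j+1)}{\sqrt{2(n-i)+1}\,\sqrt{2(n-j)+1}\,(2n-j+2)},$$ $$l=\frac{\sqrt{2(n-i)+3}\,\sqrt{2(n-j)+3}\,(2n-i-j-1)(2n-i-j+1)}{\sqrt{2(n-i)-1}\,\sqrt{2(n-j)-1}\,(2n-j)(2n-j+2)}.$$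
   Context: The matrix $D^n_1$ (rows and columns indexed $0,\dots,n$) has entries $(D^n_1)_{r,s}=2\int_0^1 h^n_r(t)\,\hat p_s(2t-1)\,dt$, where $\hat p_s$ is the Legendre polynomial of degree $s$ with positive leading coefficient, orthonormal on $[-1,1]$ ($\int_{-1}^1\hat p_r\hat p_s\,dt=\delta_{r,s}$), and the functions $h^n_r$ are defined as follows. Let $(x)_0=1$, $(x)_m=x(x+1)\cdots(x+m-1)$ for $m>0$; empty products equal $1$. For $n\ge0$, $0\le k\le n$, and $0\le p\le n$ with $p=0$ or $p$ odd, let $$d^p_{n,k}=(-1)^n\frac{\sqrt{2n-2p+1}}{(-n)_p}\frac{(-n)_k(n-p+1)_k}{(1)_k(1)_k}\prod_{m=0}^{\frac{p-1}{2}}(n+k+1-2m)\prod_{m=0}^{\frac{p-3}{2}}(n-k-1-2m).$$ For $0\le t<1$ let $h_{n-p}^n(t)=\sum_{k=0}^n d^p_{n,k}t^k$ if $p=0$ or $p$ is odd, and $h_{n-p}^n(t)=\sum_{k=0}^{n-1} d^{p-1}_{n-1,k}t^k$ if $p>0$ is even ($0\le p\le n$). *)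

theory Defs
  imports
    "HOL-Analysis.Analysis"
    "HOL-Computational_Algebra.Polynomial"
    "Jordan_Normal_Form.Matrix"
begin

definition legendre_ip :: "real poly \<Rightarrow> real poly \<Rightarrow> real" where
  "legendre_ip p q = integral {-1..1} (\<lambda>x. poly p x * poly q x)"

definition orthonormal_legendre :: "(nat \<Rightarrow> real poly) \<Rightarrow> bool" where
  "orthonormal_legendre P \<longleftrightarrow>
     (\<forall>s. degree (P s) = s \<and> lead_coeff (P s) > 0) \<and>
     (\<forall>r s. legendre_ip (P r) (P s) = (if r = s then 1 else 0))"

text \<open>
  Unique existence of the family is proved as \<open>ex1_orthonormal_legendre\<close> below.
\<close>
definition legendre_hat :: "nat \<Rightarrow> real poly" where
  "legendre_hat = (THE P. orthonormal_legendre P)"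

lemma legendre_integrable:
  "(\<lambda>x. poly p x * poly q x) integrable_on {-1..1::real}"
  by (intro integrable_continuous_real continuous_intros)

lemma legendre_ip_commute: "legendre_ip p q = legendre_ip q p"
  by (simp add: legendre_ip_def mult.commute)

lemma legendre_ip_add: "legendre_ip (p + q) r = legendre_ip p r + legendre_ip q r"
  by (simp add: legendre_ip_def distrib_right integral_add legendre_integrable)

lemma legendre_ip_diff: "legendre_ip (p - q) r = legendre_ip p r - legendre_ip q r"
  by (simp add: legendre_ip_def left_diff_distrib integral_diff legendre_integrable)

lemma legendre_ip_smult: "legendre_ip (Polynomial.smult c p) r = c * legendre_ip p r"
  by (simp add: legendre_ip_def mult.assoc)

lemma legendre_ip_0: "legendre_ip 0 r = 0"
  by (simp add: legendre_ip_def)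

lemma legendre_ip_sum: "legendre_ip (\<Sum>i\<in>A. f i) r = (\<Sum>i\<in>A. legendre_ip (f i) r)"
  by (induction A rule: infinite_finite_induct) (auto simp: legendre_ip_0 legendre_ip_add)

lemma legendre_ip_nonneg: "legendre_ip p p \<ge> 0"
  unfolding legendre_ip_def by (intro integral_nonneg legendre_integrable) auto

lemma legendre_ip_eq_0D:
  assumes "legendre_ip p p = 0"
  shows "p = 0"
proof (rule ccontr)
  assume "p \<noteq> 0"
  have "((\<lambda>x. poly p x * poly p x) has_integral 0) (cbox (-1) 1)"
    using assms legendre_integrable[of p p] by (auto simp: legendre_ip_def has_integral_iff)
  then have "poly p x * poly p x = 0" if "x \<in> cbox (-1) 1" for x :: real
    by (rule has_integral_0_cbox_imp_0[rotated 2])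
       (use that in \<open>auto intro!: continuous_intros simp: box_eq_empty\<close>)
  then have "{-1..1::real} \<subseteq> {x. poly p x = 0}"
    by auto
  then have "finite {-1..1::real}"
    using poly_roots_finite[OF \<open>p \<noteq> 0\<close>] finite_subset by blast
  then show False
    by (simp add: infinite_Icc)
qed

lemma degree_diff_less:
  fixes p q :: "real poly"
  assumes "degree p = n" "degree q = n" "Polynomial.coeff p n = Polynomial.coeff q n"
  shows "p - q = 0 \<or> degree (p - q) < n"
proof (cases n)
  case 0
  then show ?thesis
    using assms by (metis degree_eq_zeroE coeff_pCons_0 diff_self)
next
  case (Suc m)
  have "degree (p - q) \<le> n"
    using assms by (simp add: degree_diff_le)
  moreover have "Polynomial.coeff (p - q) n = 0"
    using assms by simp
  ultimately show ?thesis
    using eq_zero_or_degree_less by blast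
qed

lemma orthonormal_legendre_lower:
  assumes "orthonormal_legendre P" and "p = 0 \<or> degree p < n"
  shows "legendre_ip p (P n) = 0"
  using assms(2)
proof (induction "degree p" arbitrary: p rule: less_induct)
  case less
  show ?case
  proof (cases "p = 0")
    case False
    define m where "m = degree p"
    define c where "c = lead_coeff p / lead_coeff (P m)"
    have P: "degree (P m) = m" "lead_coeff (P m) > 0"
      using assms(1) unfolding orthonormal_legendre_def by blast+
    have m: "m < n"
      using less.prems False by (simp add: m_def)
    have c: "c \<noteq> 0"
      using False P by (simp add: c_def)
    define q where "q = p - Polynomial.smult c (P m)"
    have "q = 0 \<or> degree q < m"
      unfolding q_def using P c by (intro degree_diff_less) (auto simp: m_def c_def)
    then have "legendre_ip q (P n) = 0"
      using less.hyps[of q] m by (auto simp: m_def legendre_ip_0)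
    moreover have "legendre_ip (P m) (P n) = 0"
      using assms(1) m by (auto simp: orthonormal_legendre_def)
    ultimately show ?thesis
      by (simp add: q_def legendre_ip_diff legendre_ip_smult)
  qed (simp add: legendre_ip_0)
qed

lemma orthonormal_legendre_unique:
  assumes P: "orthonormal_legendre P" and Q: "orthonormal_legendre Q"
  shows "P = Q"
proof
  fix n
  have dP: "degree (P n) = n" "lead_coeff (P n) > 0" "legendre_ip (P n) (P n) = 1"
    using P unfolding orthonormal_legendre_def by (blast, blast, simp)
  have dQ: "degree (Q n) = n" "lead_coeff (Q n) > 0" "legendre_ip (Q n) (Q n) = 1"
    using Q unfolding orthonormal_legendre_def by (blast, blast, simp)
  define c where "c = lead_coeff (P n) / lead_coeff (Q n)"
  define R where "R = P n - Polynomial.smult c (Q n)"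
  have c: "c > 0"
    using dP dQ by (simp add: c_def)
  have R: "R = 0 \<or> degree R < n"
    unfolding R_def using dP dQ c by (intro degree_diff_less) (auto simp: c_def)
  have "legendre_ip R R = legendre_ip R (P n) - c * legendre_ip R (Q n)"
    by (subst (2) R_def)
       (metis legendre_ip_commute legendre_ip_diff legendre_ip_smult)
  then have "R = 0"
    using orthonormal_legendre_lower[OF P R] orthonormal_legendre_lower[OF Q R]
    by (simp add: legendre_ip_eq_0D)
  then have PQ: "P n = Polynomial.smult c (Q n)"
    by (simp add: R_def)
  then have "1 = c * (c * legendre_ip (Q n) (Q n))"
    using dP(3) by (metis legendre_ip_commute legendre_ip_smult)
  then have "c\<^sup>2 = 1"
    using dQ by (simp add: power2_eq_square)
  then have "c = 1"
    using c by (simp add: power2_eq_1_iff)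
  then show "P n = Q n"
    using PQ by simp
qed

fun legendre_gs :: "nat \<Rightarrow> real poly" where
  "legendre_gs n =
     (let q = Polynomial.monom 1 n -
            (\<Sum>i<n. Polynomial.smult (legendre_ip (Polynomial.monom 1 n) (legendre_gs i)) (legendre_gs i))
      in Polynomial.smult (1 / sqrt (legendre_ip q q)) q)"

declare legendre_gs.simps [simp del]

lemma legendre_gs_props:
  "degree (legendre_gs n) = n \<and> lead_coeff (legendre_gs n) > 0 \<and>
   legendre_ip (legendre_gs n) (legendre_gs n) = 1 \<and>
   (\<forall>i<n. legendre_ip (legendre_gs n) (legendre_gs i) = 0)"
proof (induction n rule: less_induct)
  case (less n)
  let ?x = "Polynomial.monom (1::real) n"
  define w where "w = (\<Sum>i<n. Polynomial.smult (legendre_ip ?x (legendre_gs i)) (legendre_gs i))"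
  define q where "q = ?x - w"
  define c where "c = 1 / sqrt (legendre_ip q q)"
  have gs: "legendre_gs n = Polynomial.smult c q"
    by (subst legendre_gs.simps) (simp add: Let_def c_def q_def w_def)
  have w: "Polynomial.coeff w k = 0" if "k \<ge> n" for k
  proof -
    have "Polynomial.coeff (legendre_gs i) k = 0" if "i < n" for i
      using less[OF that] that \<open>k \<ge> n\<close> by (intro coeff_eq_0) auto
    then show ?thesis
      by (simp add: w_def coeff_sum)
  qed
  have cq: "Polynomial.coeff q n = 1"
    by (simp add: q_def w)
  have dq: "degree q = n"
  proof (rule antisym)
    show "degree q \<le> n"
      by (rule degree_le) (auto simp: q_def w)
    show "n \<le> degree q"
      by (rule le_degree) (simp add: cq)
  qed
  have "q \<noteq> 0"
    using cq by auto
  then have pos: "legendre_ip q q > 0"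
    using legendre_ip_nonneg[of q] legendre_ip_eq_0D[of q] by fastforce
  have c: "c > 0" "c * c * legendre_ip q q = 1"
    using pos by (auto simp: c_def)
  have orth: "legendre_ip q (legendre_gs i) = 0" if i: "i < n" for i
  proof -
    have ip: "legendre_ip (legendre_gs j) (legendre_gs i) = (if j = i then 1 else 0)"
      if "j < n" for j
      using less[OF that] less[OF i] legendre_ip_commute
      by (metis linorder_neqE_nat)
    have "legendre_ip w (legendre_gs i) =
        (\<Sum>j<n. legendre_ip ?x (legendre_gs j) * (if j = i then 1 else 0))"
      unfolding w_def legendre_ip_sum legendre_ip_smult by (intro sum.cong) (auto simp: ip)
    also have "\<dots> = legendre_ip ?x (legendre_gs i)"
      using i by (simp add: sum.delta if_distrib cong: if_cong)
    finally show ?thesis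
      by (simp add: q_def legendre_ip_diff)
  qed
  have "legendre_ip (legendre_gs n) (legendre_gs n) = c * (c * legendre_ip q q)"
    unfolding gs by (metis legendre_ip_commute legendre_ip_smult)
  then show ?case
    using c dq cq orth by (auto simp: gs legendre_ip_smult mult.assoc)
qed

lemma ex1_orthonormal_legendre: "\<exists>!P. orthonormal_legendre P"
proof (rule ex1I)
  show "orthonormal_legendre legendre_gs"
    unfolding orthonormal_legendre_def
    by (metis legendre_gs_props legendre_ip_commute linorder_neqE_nat)
qed (metis legendre_gs_props legendre_ip_commute orthonormal_legendre_unique
     linorder_neqE_nat orthonormal_legendre_def)

lemma orthonormal_legendre_hat: "orthonormal_legendre legendre_hat"
  unfolding legendre_hat_def by (rule theI'[OF ex1_orthonormal_legendre])

text \<open>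
  \<open>d_coeff p n k\<close> is meant for \<open>k \<le> n\<close>, \<open>p \<le> n\<close> and \<open>p = 0\<close> or \<open>p\<close> odd.  The two products have
  upper limits \<open>(p-1)/2\<close> and \<open>(p-3)/2\<close>, hence \<open>(p+1)/2\<close> and \<open>(p-1)/2\<close> factors for odd \<open>p\<close>
  and none for \<open>p = 0\<close>; truncating division and subtraction give exactly these counts.
\<close>
definition d_coeff :: "nat \<Rightarrow> nat \<Rightarrow> nat \<Rightarrow> real" where
  "d_coeff p n k =
     (-1) ^ n * (sqrt (2 * real n - 2 * real p + 1) / pochhammer (- real n) p)
     * ((pochhammer (- real n) k * pochhammer (real n - real p + 1) k)
        / (pochhammer 1 k * pochhammer 1 k))
     * (\<Prod>m<(p + 1) div 2. real n + real k + 1 - 2 * real m)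
     * (\<Prod>m<(p - 1) div 2. real n - real k - 1 - 2 * real m)"

text \<open>
  \<open>h_fun n r\<close> is \<open>h\<^sup>n\<^sub>r\<close> on \<open>[0,1)\<close>, indexed by \<open>r = n - p\<close> for \<open>r \<le> n\<close>.  The polynomial
  expression is used for all arguments; only its values on \<open>[0,1)\<close> affect the integral below.
\<close>
definition h_fun :: "nat \<Rightarrow> nat \<Rightarrow> real \<Rightarrow> real" where
  "h_fun n r t =
     (let p = n - r in
      if p = 0 \<or> odd p then \<Sum>k=0..n. d_coeff p n k * t ^ k
      else \<Sum>k=0..n-1. d_coeff (p - 1) (n - 1) k * t ^ k)"

definition D1 :: "nat \<Rightarrow> real mat" where
  "D1 n = mat (n + 1) (n + 1)
     (\<lambda>(r, s). 2 * integral {0..1} (\<lambda>t. h_fun n r t * poly (legendre_hat s) (2 * t - 1)))"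

end

theory Submission
  imports Defs
begin

text \<open>
  The recurrence is a three-term recurrence for a terminating balanced hypergeometric sum.

  The moments of the shifted Legendre polynomials are quotients of factorials
  (\<open>legendre_moment_eq\<close>), so every entry of the matrix is a finite hypergeometric sum over the
  powers \<open>t ^ k\<close>.  Only powers with \<open>N - j \<le> k \<le> N\<close> contribute, by orthogonality.  Among these,
  because \<open>j < i\<close> and \<open>i\<close> is odd, a factor of the coefficient vanishes whenever \<open>N - k\<close> is odd,
  so that \<open>k = N - 2 * q\<close> with \<open>q \<le> j div 2\<close> (\<open>D1_entry_eq\<close>).  The squares of factorials cancel,
  and what remains is a factor independent of \<open>q\<close> times a \<open>4F3\<close> series at \<open>1\<close> with upper parameters
  \<open>-j/2\<close>, \<open>(1-j)/2\<close>, \<open>(j-1)/2-N\<close>, \<open>j/2-N\<close> and lower parameters \<open>(i+1)/2-N\<close>, \<open>1-i/2\<close>, \<open>-N-1/2\<close>.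

  Such a series satisfies a linear recurrence of order two in \<open>N\<close>.  It is proved by creative
  telescoping: \<open>certificate_identity\<close> writes the weighted combination of the summands for
  \<open>n + 1\<close>, \<open>n\<close>, \<open>n - 1\<close> as a difference of consecutive values of a hypergeometric term, and this
  term vanishes at both ends of the summation (\<open>sum_entry_term_recurrence\<close>).  In the variables
  \<open>J = 2 * n - j\<close> and \<open>w = J - i\<close> the weights are polynomials, and dividing by the leading one gives the coefficients of the theorem.
\<close>

section \<open>Moments of the shifted Legendre polynomials\<close>

lemma pochhammer_Suc_of_nat: "pochhammer (real m + 1) k = fact (m + k) / fact m"
  using pochhammer_product'[of "1::real" m k] by (simp add: pochhammer_fact[symmetric] add.commute)

lemma has_integral_affine_unit:
  fixes f :: "real \<Rightarrow> real"
  assumes "(f has_integral I) {-1..1}"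
  shows "((\<lambda>t. f (2 * t - 1)) has_integral I / 2) {0..1}"
proof -
  have "(\<lambda>x::real. x / 2 + 1 / 2) ` {-1..1} = {0..1}"
    by (subst image_affinity_atLeastAtMost_div) auto
  then show ?thesis
    using has_integral_affinity[of f I "-1" 1 2 "-1"] assms by (simp add: algebra_simps)
qed

lemma integral_poly_unit:
  "integral {0..1} (\<lambda>t. t ^ k * poly p t) = (\<Sum>m\<le>degree p. coeff p m / (real k + real m + 1))"
proof -
  have "((\<lambda>t::real. t ^ n) has_integral 1 / (real n + 1)) {0..1}" for n
  proof -
    have "((\<lambda>t. t ^ n) has_integral 1 ^ Suc n / (real n + 1) - 0 ^ Suc n / (real n + 1)) {0..1::real}"
    proof (rule fundamental_theorem_of_calculus)
      fix t :: real
      have "((\<lambda>t. t ^ Suc n / (real n + 1)) has_real_derivative (real n + 1) * t ^ n / (real n + 1))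
          (at t within {0..1})"
        by (auto intro!: derivative_eq_intros simp: add.commute simp del: power_Suc)
      then show "((\<lambda>t. t ^ Suc n / (real n + 1)) has_vector_derivative t ^ n) (at t within {0..1})"
        by (simp add: has_real_derivative_iff_has_vector_derivative add.commute del: power_Suc)
    qed simp
    then show ?thesis
      by simp
  qed
  then have "((\<lambda>t. \<Sum>m\<le>degree p. coeff p m * t ^ (k + m))
      has_integral (\<Sum>m\<le>degree p. coeff p m * (1 / (real (k + m) + 1)))) {0..1}"
    by (intro has_integral_sum has_integral_mult_right) (auto simp del: of_nat_add)
  then show ?thesis
    by (simp add: poly_altdef sum_distrib_left power_add mult.left_commute integral_unique add.assoc)
qed

definition legendre_moment :: "nat \<Rightarrow> nat \<Rightarrow> real" where
  "legendre_moment s k = integral {0..1} (\<lambda>t. t ^ k * poly (legendre_hat s) (2 * t - 1))"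

text \<open>
  After the substitution \<open>x = 2 * t - 1\<close> the monomial \<open>t ^ k\<close> becomes a polynomial of degree \<open>k\<close>,
  and the Legendre polynomial of degree \<open>s\<close> is orthogonal to all polynomials of lower degree.
\<close>
lemma legendre_moment_eq_0:
  assumes "k < s"
  shows "legendre_moment s k = 0"
proof -
  let ?q = "[:1/2, 1/2:] ^ k :: real poly"
  have "degree ?q = k"
    by (simp add: degree_power_eq)
  then have "legendre_ip ?q (legendre_hat s) = 0"
    using orthonormal_legendre_lower[OF orthonormal_legendre_hat] assms by simp
  then have "((\<lambda>x. poly ?q x * poly (legendre_hat s) x) has_integral 0) {-1..1}"
    using legendre_integrable[of ?q "legendre_hat s"] by (simp only: legendre_ip_def has_integral_iff)
  from has_integral_affine_unit[OF this] show ?thesis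
    by (simp add: legendre_moment_def has_integral_iff algebra_simps)
qed

text \<open>
  The \<open>c m\<close> are the coefficients of the shifted polynomial, so the leading one is positive.
  Orthogonality leaves only the leading coefficient in the integral of the square of the shifted
  polynomial, which turns the normalisation into the last relation.
\<close>
lemma legendre_moment_partial_fractions:
  obtains c :: "nat \<Rightarrow> real" where
    "\<And>k. legendre_moment s k = (\<Sum>m\<le>s. c m / (real k + real m + 1))"
    "c s > 0" "2 * c s * legendre_moment s s = 1"
proof -
  let ?P = "legendre_hat s"
  define Q where "Q = pcompose ?P [:-1, 2:]"
  have P: "degree ?P = s" "lead_coeff ?P > 0" "legendre_ip ?P ?P = 1"
    using orthonormal_legendre_hat unfolding orthonormal_legendre_def by (blast, blast, simp)
  have Q: "poly Q t = poly ?P (2 * t - 1)" for t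
    by (simp add: Q_def poly_pcompose algebra_simps)
  have dQ: "degree Q = s"
    by (simp add: Q_def P degree_pcompose)
  have moment: "legendre_moment s k = (\<Sum>m\<le>s. coeff Q m / (real k + real m + 1))" for k
    using integral_poly_unit[of k Q] by (simp add: legendre_moment_def Q dQ)
  have "coeff Q s = coeff ?P s * 2 ^ s"
    using lead_coeff_comp[of "[:-1, 2:]" ?P] by (simp add: Q_def[symmetric] dQ P)
  then have pos: "coeff Q s > 0"
    using P by simp
  have "((\<lambda>x. poly ?P x * poly ?P x) has_integral 1) {-1..1}"
    using legendre_integrable P(3) by (simp add: legendre_ip_def has_integral_iff)
  then have "((\<lambda>t. poly ?P (2 * t - 1) * poly ?P (2 * t - 1)) has_integral 1 / 2) {0..1}"
    by (rule has_integral_affine_unit)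
  then have "1 / 2 = integral {0..1} (\<lambda>t. poly Q t * poly ?P (2 * t - 1))"
    by (simp add: Q has_integral_iff)
  also have "\<dots> = integral {0..1} (\<lambda>t. \<Sum>m\<le>s. coeff Q m * (t ^ m * poly ?P (2 * t - 1)))"
    by (simp add: poly_altdef[of Q] dQ sum_distrib_right mult.assoc)
  also have "\<dots> = (\<Sum>m\<le>s. coeff Q m * legendre_moment s m)"
    unfolding legendre_moment_def
    by (subst integral_sum)
       (auto intro!: integrable_continuous_real continuous_intros)
  also have "\<dots> = (\<Sum>m\<in>{s}. coeff Q m * legendre_moment s m)"
    by (rule sum.mono_neutral_right) (auto simp: legendre_moment_eq_0)
  finally have "2 * coeff Q s * legendre_moment s s = 1"
    by simp
  then show ?thesis
    using that[of "coeff Q"] moment pos by blast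
qed

text \<open>
  The formula is read off without knowing the Legendre polynomials explicitly.  As a function
  of \<open>k\<close>, the moment is a partial fraction with simple poles at \<open>-1, \<dots>, -s-1\<close>; over the common
  denominator its numerator \<open>N\<close> has degree at most \<open>s\<close> and, by orthogonality, the roots
  \<open>0, \<dots>, s-1\<close>.  Hence \<open>N\<close> is a multiple of \<open>k * (k - 1) * \<dots> * (k - s + 1)\<close>.  The factor follows,
  up to sign, by comparing the residue at \<open>-s-1\<close> with the normalisation; the sign is that of the
  leading coefficient.
\<close>
lemma legendre_moment_eq:
  assumes "s \<le> k"
  shows "legendre_moment s k
    = sqrt ((2 * real s + 1) / 2) * (fact k)\<^sup>2 / (fact (k - s) * fact (k + s + 1))"
proof -
  obtain c where c: "\<And>k. legendre_moment s k = (\<Sum>m\<le>s. c m / (real k + real m + 1))"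
    "c s > 0" "2 * c s * legendre_moment s s = 1"
    using legendre_moment_partial_fractions[of s] by blast
  define N where "N = (\<Sum>m\<le>s. Polynomial.smult (c m) (\<Prod>l\<in>{..s} - {m}. [:real l + 1, 1:]))"
  define W where "W = (\<Prod>l<s. [:- real l, 1:])"
  have N_nat: "poly N (real k) = legendre_moment s k * (\<Prod>l\<le>s. real k + real l + 1)" for k
  proof -
    have "c m * (\<Prod>l\<in>{..s} - {m}. real k + real l + 1)
        = c m / (real k + real m + 1) * (\<Prod>l\<le>s. real k + real l + 1)" if "m \<le> s" for m
      using that by (subst prod.remove[of "{..s}" m]) auto
    then show ?thesis
      by (simp add: N_def c(1) poly_sum poly_prod sum_distrib_right add.commute add.left_commute)
  qed
  have degN: "degree N \<le> s"
    unfolding N_def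
  proof (intro degree_sum_le finite_atMost)
    fix m assume m: "m \<in> {..s}"
    have "degree (\<Prod>l\<in>{..s} - {m}. [:real l + 1, 1:]) \<le> (\<Sum>l\<in>{..s} - {m}. 1)"
      by (rule order.trans[OF degree_prod_sum_le]) (auto intro: sum_mono)
    also have "\<dots> = s"
      using m by simp
    finally show "degree (Polynomial.smult (c m) (\<Prod>l\<in>{..s} - {m}. [:real l + 1, 1:])) \<le> s"
      using degree_smult_le order.trans by blast
  qed
  have degW: "degree W \<le> s"
    unfolding W_def by (rule order.trans[OF degree_prod_sum_le]) (auto intro: order.trans[OF sum_mono[where g = "\<lambda>_. 1"]])
  \<comment> \<open>At \<open>-s-1\<close> only the summand of \<open>N\<close> with \<open>m = s\<close> survives, which ties the unknown factor to \<open>c s\<close>.\<close>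
  define x where "x = - real s - 1"
  have Wx: "poly W x = (-1) ^ s * (fact (2 * s) / fact s)"
  proof -
    have "poly W x = (\<Prod>l<s. - (real s + 1 + real l))"
      by (auto simp: W_def poly_prod x_def intro!: prod.cong)
    also have "\<dots> = (-1) ^ s * pochhammer (real s + 1) s"
      by (simp only: prod_uminus card_lessThan pochhammer_prod atLeast0LessThan)
    also have "pochhammer (real s + 1) s = fact (2 * s) / fact s"
      by (simp add: pochhammer_Suc_of_nat mult_2)
    finally show ?thesis .
  qed
  have Nx: "poly N x = c s * ((-1) ^ s * fact s)"
  proof -
    have "poly N x = (\<Sum>m\<le>s. c m * (\<Prod>l\<in>{..s} - {m}. real l - real s))"
      by (simp add: N_def poly_sum poly_prod x_def)
    also have "\<dots> = (\<Sum>m\<in>{s}. c m * (\<Prod>l\<in>{..s} - {m}. real l - real s))"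
      by (rule sum.mono_neutral_right) auto
    also have "\<dots> = c s * (\<Prod>l<s. - (real s - real l))"
      by (simp add: lessThan_Suc_atMost[symmetric] lessThan_Suc)
    also have "(\<Prod>l<s. - (real s - real l)) = (-1) ^ s * (\<Prod>l<s. real s - real l)"
      by (simp only: prod_uminus card_lessThan)
    also have "(\<Prod>l<s. real s - real l) = fact s"
      by (simp add: fact_prod_rev atLeast0LessThan of_nat_diff)
    finally show ?thesis .
  qed
  define \<kappa> where "\<kappa> = c s * (fact s)\<^sup>2 / fact (2 * s)"
  have NW: "N = Polynomial.smult \<kappa> W"
  proof (rule poly_eqI_degree)
    fix u assume "u \<in> insert x (real ` {..<s})"
    then consider "u = x" | l where "l < s" "u = real l"
      by auto
    then show "poly N u = poly (Polynomial.smult \<kappa> W) u"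
    proof cases
      case 1
      then show ?thesis
        by (simp add: Nx Wx \<kappa>_def power2_eq_square)
    next
      case 2
      then show ?thesis
        by (auto simp: N_nat legendre_moment_eq_0 W_def poly_prod)
    qed
  next
    have "card (insert x (real ` {..<s})) = s + 1"
      by (subst card_insert_disjoint) (auto simp: x_def card_image)
    then show "card (insert x (real ` {..<s})) > degree N"
      "card (insert x (real ` {..<s})) > degree (Polynomial.smult \<kappa> W)"
      using degN degW by (auto intro: le_less_trans[OF degree_smult_le])
  qed
  have moment: "legendre_moment s k = \<kappa> * (fact k)\<^sup>2 / (fact (k - s) * fact (k + s + 1))"
    if "s \<le> k" for k
  proof -
    have "poly W (real k) = (\<Prod>l<s. real k - real l)"
      by (simp add: W_def poly_prod)
    also have "\<dots> = fact k / fact (k - s)"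
      using that fact_binomial[of s k, where 'a = real]
      by (simp add: binomial_fact gbinomial_prod_rev binomial_gbinomial atLeast0LessThan field_simps)
    finally have W: "poly W (real k) = fact k / fact (k - s)" .
    have "(\<Prod>l\<le>s. real k + real l + 1) = pochhammer (real k + 1) (s + 1)"
      by (simp add: pochhammer_prod atLeast0LessThan lessThan_Suc_atMost algebra_simps del: prod.lessThan_Suc)
    also have "\<dots> = fact (k + s + 1) / fact k"
      using pochhammer_Suc_of_nat[of k "s + 1"] by (simp only: add.assoc)
    finally have "\<kappa> * (fact k / fact (k - s)) = legendre_moment s k * (fact (k + s + 1) / fact k)"
      using N_nat[of k] by (simp only: NW poly_smult W)
    moreover have "m = c * a\<^sup>2 / (b * f)"
      if "c * (a / b) = m * (f / a)" "a \<noteq> 0" "b \<noteq> 0" "f \<noteq> 0" for a b c f m :: real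
      using that by (simp add: power2_eq_square field_simps)
    ultimately show ?thesis
      by (simp del: fact_Suc)
  qed
  have eq1: "c s * (fact s)\<^sup>2 = \<kappa> * fact (2 * s)"
    by (simp add: \<kappa>_def)
  have fact_odd: "fact (s + s + 1) = (2 * real s + 1) * fact (2 * s)"
    using fact_Suc[of "2 * s", where 'a = real]
    by (simp only: mult_2 Suc_eq_plus1 of_nat_add of_nat_1)
  then have "(2 * real s + 1) * fact (2 * s) \<noteq> (0 :: real)"
    by (metis fact_nonzero)
  then have eq2: "legendre_moment s s * ((2 * real s + 1) * fact (2 * s)) = \<kappa> * (fact s)\<^sup>2"
    unfolding moment[OF order.refl] fact_odd diff_self_eq_0 fact_0 mult_1
    by (rule nonzero_eq_divide_eq[THEN iffD1, OF _ refl])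
  have "(c s * legendre_moment s s * (2 * real s + 1)) * ((fact s)\<^sup>2 * fact (2 * s))
      = (c s * (fact s)\<^sup>2) * (legendre_moment s s * ((2 * real s + 1) * fact (2 * s)))"
    by (simp only: mult_ac)
  also have "\<dots> = \<kappa>\<^sup>2 * ((fact s)\<^sup>2 * fact (2 * s))"
    unfolding eq1 eq2 by (simp only: power2_eq_square mult_ac)
  finally have "c s * legendre_moment s s * (2 * real s + 1) = \<kappa>\<^sup>2"
    by (simp only: mult_cancel_right mult_eq_0_iff power_eq_0_iff fact_nonzero simp_thms)
  moreover have "c s * legendre_moment s s = 1 / 2"
    using c(3) by simp
  ultimately have "\<kappa>\<^sup>2 = (2 * real s + 1) / 2"
    by simp
  moreover have "\<kappa> > 0"
    using c(2) by (simp add: \<kappa>_def)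
  ultimately have "sqrt ((2 * real s + 1) / 2) = \<kappa>"
    by (intro real_sqrt_unique) auto
  then show ?thesis
    using moment[OF assms] by simp
qed

section \<open>The hypergeometric terms and their recurrence\<close>

definition falling_by_two :: "real \<Rightarrow> nat \<Rightarrow> real" where
  "falling_by_two x m = (\<Prod>l<m. x - 2 * real l)"

lemma falling_by_two_shift:
  "falling_by_two (x + 2) m * (x + 2 - 2 * real m) = falling_by_two x m * (x + 2)"
  by (induction m) (simp_all add: falling_by_two_def algebra_simps)

text \<open>
  Up to the factor of lemma \<open>D1_entry_eq\<close>, this is the contribution of the power \<open>t ^ (N - 2 * q)\<close>
  to the entry in row \<open>N - i\<close> and column \<open>N - j\<close>.  For odd \<open>i > j\<close> the powers
  \<open>t ^ k\<close> with odd \<open>N - k\<close> contribute nothing.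
\<close>
definition entry_term :: "nat \<Rightarrow> nat \<Rightarrow> nat \<Rightarrow> nat \<Rightarrow> real" where
  "entry_term i j N q =
     fact (2 * N - i - 2 * q) / (fact (2 * q) * fact (j - 2 * q) * fact (2 * N - 2 * q - j + 1))
     * falling_by_two (2 * real N - 2 * real q + 1) ((i + 1) div 2)
     * falling_by_two (2 * real q - 1) ((i - 1) div 2)"

lemma fact_two_steps:
  fixes u v :: real
  assumes "M = m + 2" and "u = real m + 2" and "v = real m + 1"
  shows "fact M = u * v * fact m"
  using assms by (simp add: algebra_simps)

lemma cancel_factors_order:
  fixes t u v :: real
  assumes "t \<noteq> 0" "u \<noteq> 0" "v \<noteq> 0"
  shows "t * s * F / (a * b * (u * v * G)) * (E * r / t) * E2 * (u * v)
       = F / (a * b * G) * E * E2 * (s * r)"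
  by (cases "a = 0 \<or> b = 0 \<or> G = 0") (use assms in \<open>auto simp: field_simps\<close>)

lemma cancel_factors_index:
  fixes t u v :: real
  assumes "t \<noteq> 0" "u \<noteq> 0" "v \<noteq> 0" "m \<noteq> 0" "m' \<noteq> 0" "c \<noteq> 0" "c' \<noteq> 0" "r \<noteq> 0" "o2 \<noteq> 0"
  shows "F / (c * c' * a * b * G) * E * (E2 * c' / r) * (c * r * s * o2)
       = t * s * F / (a * (m * m' * b) * (u * v * G)) * (E * o2 / t) * E2 * (m * m' * u * v)"
  by (cases "a = 0 \<or> b = 0 \<or> G = 0") (use assms in \<open>auto simp: field_simps\<close>)

text \<open>
  Neighbouring terms, both in \<open>N\<close> and in \<open>q\<close>, have rational quotients because each factorial or
  product gains or loses one or two factors.  The quotients are stated without division, so that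
  the telescoping argument can divide where it has the signs at hand.
\<close>
lemma entry_term_Suc_N:
  fixes i j N q :: nat and y :: real
  defines "y \<equiv> 2 * real N - 2 * real q"
  assumes "odd i" "2 * q \<le> j" "j < i" "i \<le> N"
  shows "entry_term i j (Suc N) q * ((y - j + 3) * (y - j + 2))
       = entry_term i j N q * ((y - i + 1) * (y + 3))"
proof -
  obtain P where P: "i = 2 * P + 1" using \<open>odd i\<close> by (auto elim: oddE)
  have 1: "fact (2 * Suc N - i - 2 * q) = (y - i + 2) * (y - i + 1) * fact (2 * N - i - 2 * q)"
    by (rule fact_two_steps) (use assms(3-5) in \<open>auto simp: y_def of_nat_diff\<close>)
  have 2: "fact (2 * Suc N - 2 * q - j + 1)
      = (y - j + 3) * (y - j + 2) * fact (2 * N - 2 * q - j + 1)"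
    by (rule fact_two_steps) (use assms(3-5) in \<open>auto simp: y_def of_nat_diff\<close>)
  have 3: "falling_by_two (2 * real (Suc N) - 2 * real q + 1) (P + 1) * (y - i + 2)
      = falling_by_two (2 * real N - 2 * real q + 1) (P + 1) * (y + 3)"
    using falling_by_two_shift[of "y + 1" "P + 1"] by (simp add: P y_def algebra_simps)
  have pos: "y - j + 3 > 0" "y - j + 2 > 0" "y - i + 2 > 0"
    using assms by (auto simp: y_def)
  have 4: "falling_by_two (2 * real (Suc N) - 2 * real q + 1) (P + 1)
      = falling_by_two (2 * real N - 2 * real q + 1) (P + 1) * (y + 3) / (y - i + 2)"
    using 3 pos by (simp add: eq_divide_eq)
  have i: "(i + 1) div 2 = P + 1" "(i - 1) div 2 = P" by (auto simp: P)
  show ?thesis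
    unfolding entry_term_def 1 2 i 4
    by (rule cancel_factors_order) (use pos in auto)
qed

lemma entry_term_Suc_q:
  fixes i j N q :: nat and y :: real
  defines "y \<equiv> 2 * real N - 2 * real q"
  assumes "odd i" "2 * q + 2 \<le> j" "j < i" "i \<le> N"
  shows "entry_term i j N (Suc q) * ((2 * real q + 2) * (2 * real q + 2 - i) * (y - i - 1) * (y + 1))
       = entry_term i j N q * ((real j - 2 * real q) * (real j - 2 * real q - 1) * (y - j + 1) * (y - j))"
proof -
  obtain P where P: "i = 2 * P + 1" using \<open>odd i\<close> by (auto elim: oddE)
  have 1: "fact (2 * N - i - 2 * q) = (y - i) * (y - i - 1) * fact (2 * N - i - 2 * Suc q)"
    by (rule fact_two_steps) (use assms(3-5) in \<open>auto simp: y_def of_nat_diff\<close>)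
  have 2: "fact (2 * N - 2 * q - j + 1)
      = (y - j + 1) * (y - j) * fact (2 * N - 2 * Suc q - j + 1)"
    by (rule fact_two_steps) (use assms(3-5) in \<open>auto simp: y_def of_nat_diff\<close>)
  have 3: "fact (j - 2 * q) = (real j - 2 * real q) * (real j - 2 * real q - 1) * fact (j - 2 * Suc q)"
    by (rule fact_two_steps) (use assms(3-5) in \<open>auto simp: y_def of_nat_diff\<close>)
  have 4: "fact (2 * Suc q) = (2 * real q + 2) * (2 * real q + 1) * fact (2 * q)"
    by (simp add: algebra_simps)
  have 5: "falling_by_two (2 * real N - 2 * real q + 1) (P + 1)
      = falling_by_two (2 * real N - 2 * real (Suc q) + 1) (P + 1) * (y + 1) / (y - i)"
    using falling_by_two_shift[of "y - 1" "P + 1"] assms by (simp add: P y_def field_simps)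
  have ne: "2 * real q + 2 - real i \<noteq> 0"
  proof
    assume "2 * real q + 2 - real i = 0"
    then have "real (2 * q + 2) = real i" by simp
    then have "2 * q + 2 = i" by (simp only: of_nat_eq_iff)
    then show False using \<open>odd i\<close> by auto
  qed
  have 6: "falling_by_two (2 * real (Suc q) - 1) P
      = falling_by_two (2 * real q - 1) P * (2 * real q + 1) / (2 * real q + 2 - real i)"
    using falling_by_two_shift[of "2 * real q - 1" "P"] ne by (simp add: P field_simps)
  have pos: "y - j + 1 > 0" "y - j > 0" "y - i > 0" "y - i - 1 > 0" "y + 1 > 0"
    "real j - 2 * real q > 0" "real j - 2 * real q - 1 > 0" "2 * real q + 2 > 0" "2 * real q + 1 > 0"
    using assms by (auto simp: y_def)
  have i: "(i + 1) div 2 = P + 1" "(i - 1) div 2 = P" by (auto simp: P)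
  show ?thesis
    unfolding entry_term_def 1 2 3 4 5 6 i
    by (rule cancel_factors_index) (use pos ne in auto)
qed

text \<open>
  This polynomial identity is a creative-telescoping certificate.  For odd \<open>i\<close>, the quotients of
  neighbouring terms show that the combination of three terms with weights \<open>A\<close>, \<open>B\<close>, \<open>C\<close> is a common
  hypergeometric factor \<open>V q\<close> times the left-hand side, where \<open>x = J - 2 * q\<close>, and that the
  right-hand side is, after multiplication by \<open>V q\<close>, a difference of consecutive values.

  The quadratic cofactor \<open>Z u = z2 - (z3 - z2) * u + z * (u * (u + 1))\<close> appears as \<open>Z x\<close> and
  \<open>Z (x + 2)\<close>.  Its values \<open>z2\<close> at \<open>0\<close> and \<open>z3\<close> at \<open>-1\<close> are forced by the cases \<open>x = -2\<close> and \<open>x = -3\<close>,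
  in which only the term with \<open>A\<close> survives on the left and only the term with \<open>Z (x + 2)\<close> on the
  right.  With a quadratic cofactor the terms of degree six and five in \<open>x\<close> on the right cancel, so
  that comparing coefficients gives five linear equations for the six unknowns \<open>A\<close>, \<open>B\<close>, \<open>C\<close>, \<open>z2\<close>,
  \<open>z3\<close>, \<open>z\<close>; below is a solution.
\<close>
lemma certificate_identity:
  fixes x j J w A B C z2 z3 z :: real
  assumes "A = (J + 2) * (J + 3) * (w + 2) * (w + 3) * (J + w + 1)"
    and "B = j * (J - w - j - 1) * (J + w + 1) * (J + w + 3) * (J + w + 5)
             - w * J * (J + 1) * (J + 2) * (J + w + 5)
             - (J + 3) * (w + 1) * (w + 2) * (w + 3) * (J + w + 1)"
    and "C = (w - 1) * w * (J + 1) * (J + 2) * (J + w + 5)"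
    and "z2 = (J + 3) * (w + 3) * (J + w + 1) * (J - w + 1 - j) * (j + 1)"
    and "z3 = (J + 2) * (w + 2) * (J + w + 1) * j * (J - w + 2 - j)"
    and "z = (2 * (J - w) - 2) * (J * J) + (10 * (J - w) - (J - w) * (J - w) - 5) * J
             + (10 * (J - w) - 3 * ((J - w) * (J - w)) + 1) - j * (J + w + 1) * (J + w + 5)"
  shows "A * ((x + j - J + w + 1) * (x + j + 3) * ((x + j - J + w - 1) * (x + j + 1)))
       + B * ((x + 3) * (x + 2) * ((x + j - J + w - 1) * (x + j + 1)))
       + C * ((x + 1) * x * (x + 3) * (x + 2))
       = (j - J + x) * (j - J + x - 1) * (x + 3) * (x + 2)
           * (z2 - (z3 - z2) * x + z * (x * (x + 1)))
         - (J - x) * (w - x) * ((x + j - J + w - 1) * (x + j + 1))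
           * (z2 - (z3 - z2) * (x + 2) + z * ((x + 2) * (x + 2 + 1)))"
  unfolding assms by Groebner_Basis.algebra

text \<open>
  The certificate makes the partial sums of the weighted combination equal to
  \<open>V Q * L Q * Z (x Q)\<close>.  The factor \<open>L Q\<close> contains \<open>(j - 2 * Q) * (j - 2 * Q - 1)\<close>, which vanishes at
  \<open>Q = j div 2\<close> for either parity of \<open>j\<close>.  This is why the recurrence has no inhomogeneous part.
\<close>
lemma sum_entry_term_recurrence:
  fixes i j n :: nat and J w A B C :: real
  defines "J \<equiv> 2 * real n - real j" and "w \<equiv> 2 * real n - real j - real i"
  defines "A \<equiv> (J + 2) * (J + 3) * (w + 2) * (w + 3) * (J + w + 1)"
    and "B \<equiv> real j * (real i - real j - 1) * (J + w + 1) * (J + w + 3) * (J + w + 5)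
             - w * J * (J + 1) * (J + 2) * (J + w + 5)
             - (J + 3) * (w + 1) * (w + 2) * (w + 3) * (J + w + 1)"
    and "C \<equiv> (w - 1) * w * (J + 1) * (J + 2) * (J + w + 5)"
  assumes "odd i" "j < i" "i < n"
  shows "A * (\<Sum>q\<le>j div 2. entry_term i j (n + 1) q) + B * (\<Sum>q\<le>j div 2. entry_term i j n q)
       + C * (\<Sum>q\<le>j div 2. entry_term i j (n - 1) q) = 0"
proof -
  \<comment> \<open>\<open>Z\<close> is the cofactor of the certificate, \<open>V\<close> the factor common to the three terms, and \<open>x q\<close> stands
    for \<open>J - 2 * q\<close>; in these variables the row offset is \<open>i = J - w\<close>.\<close>
  define z2 where "z2 = (J + 3) * (w + 3) * (J + w + 1) * (J - w + 1 - j) * (real j + 1)"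
  define z3 where "z3 = (J + 2) * (w + 2) * (J + w + 1) * j * (J - w + 2 - j)"
  define z where "z = (2 * (J - w) - 2) * (J * J) + (10 * (J - w) - (J - w) * (J - w) - 5) * J
      + (10 * (J - w) - 3 * ((J - w) * (J - w)) + 1) - j * (J + w + 1) * (J + w + 5)"
  define Z where "Z u = z2 - (z3 - z2) * u + z * (u * (u + 1))" for u
  define x where "x q = J - 2 * real q" for q
  define \<kappa> where "\<kappa> q = (x q + j - J + w - 1) * (x q + j + 1)" for q
  define V where "V q = entry_term i j n q / ((x q + 3) * (x q + 2) * \<kappa> q)" for q
  define L where "L q = (j - J + x q) * (j - J + x q - 1) * (x q + 3) * (x q + 2)" for q
  have iw: "real i = J - w"
    by (simp add: J_def w_def)
  have eqs: "x q + real j - real j = x q" "x q + real j - real i = x q + j - J + w"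
    "2 * real n - 2 * real q = x q + j" "real j - 2 * real q = j - J + x q"
    "x (Suc q) = x q - 2" for q
    by (simp_all add: x_def J_def w_def)
  have pos: "x q > 0" "x q + j - J + w - 1 > 0" if "2 * q \<le> j" for q
    using assms(6-) that by (auto simp: x_def J_def w_def)
  have summand: "A * entry_term i j (n + 1) q + B * entry_term i j n q + C * entry_term i j (n - 1) q
      = V q * (L q * Z (x q) - (J - x q) * (w - x q) * \<kappa> q * Z (x q + 2))"
    if q: "2 * q \<le> j" for q
  proof -
    have p: "x q > 0" "x q + j - J + w - 1 > 0" "\<kappa> q > 0"
      using pos[OF q] by (auto simp: \<kappa>_def)
    have h: "entry_term i j (Suc n) q * ((x q + 3) * (x q + 2))
        = entry_term i j n q * ((x q + j - J + w + 1) * (x q + j + 3))"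
      using entry_term_Suc_N[OF \<open>odd i\<close> q \<open>j < i\<close>, of n] \<open>i < n\<close> by (simp only: eqs less_imp_le simp_thms)
    have "V q * ((x q + j - J + w + 1) * (x q + j + 3) * \<kappa> q)
        = entry_term i j n q * ((x q + j - J + w + 1) * (x q + j + 3)) / ((x q + 3) * (x q + 2))"
      using p by (simp add: V_def)
    also have "\<dots> = entry_term i j (n + 1) q"
      unfolding h[symmetric] using p by simp
    finally have up: "entry_term i j (n + 1) q = V q * ((x q + j - J + w + 1) * (x q + j + 3) * \<kappa> q)" ..
    have e: "2 * real (n - 1) - 2 * real q = x q + j - 2" "x q + j - 2 - real j + 3 = x q + 1"
      "x q + j - 2 - real j + 2 = x q" "x q + j - 2 - real i + 1 = x q + j - J + w - 1"
      "x q + j - 2 + 3 = x q + j + 1" "Suc (n - 1) = n" "(i \<le> n - 1) = True"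
      using \<open>i < n\<close> by (auto simp: x_def J_def w_def of_nat_diff)
    have h': "entry_term i j n q * ((x q + 1) * x q) = entry_term i j (n - 1) q * \<kappa> q"
      using entry_term_Suc_N[OF \<open>odd i\<close> q \<open>j < i\<close>, of "n - 1"]
      by (simp only: e \<kappa>_def simp_thms)
    have "V q * ((x q + 1) * x q * (x q + 3) * (x q + 2)) = entry_term i j n q * ((x q + 1) * x q) / \<kappa> q"
      using p by (simp add: V_def)
    also have "\<dots> = entry_term i j (n - 1) q"
      unfolding h' using p by simp
    finally have down: "entry_term i j (n - 1) q = V q * ((x q + 1) * x q * (x q + 3) * (x q + 2))" ..
    have mid: "entry_term i j n q = V q * ((x q + 3) * (x q + 2) * \<kappa> q)"
      using p by (simp add: V_def)
    have certificate: "A * ((x q + j - J + w + 1) * (x q + j + 3) * \<kappa> q)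
        + B * ((x q + 3) * (x q + 2) * \<kappa> q) + C * ((x q + 1) * x q * (x q + 3) * (x q + 2))
        = L q * Z (x q) - (J - x q) * (w - x q) * \<kappa> q * Z (x q + 2)"
      unfolding Z_def L_def \<kappa>_def
      by (rule certificate_identity) (simp_all only: A_def B_def C_def z2_def z3_def z_def iw)
    have distrib: "A * (v * r) + B * (v * s) + C * (v * t) = v * (A * r + B * s + C * t)"
      for v r s t :: real
      by (simp add: algebra_simps)
    show ?thesis
      unfolding up mid down distrib certificate ..
  qed
  have shift: "V (Suc q) * ((J - x (Suc q)) * (w - x (Suc q)) * \<kappa> (Suc q)) = V q * L q"
    if q: "2 * q + 2 \<le> j" for q
  proof -
    have p: "x q > 0" "x q - 2 > 0" "\<kappa> q > 0" "\<kappa> (Suc q) > 0"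
      using pos[of q] pos[of "Suc q"] q by (auto simp: \<kappa>_def eqs)
    have r: "2 * real q + 2 = J - x (Suc q)" "J - x (Suc q) - real i = w - x (Suc q)"
      by (simp_all add: x_def J_def w_def)
    have "entry_term i j n (Suc q) * ((J - x (Suc q)) * (w - x (Suc q)) * (x q + j - J + w - 1) * (x q + j + 1))
        = entry_term i j n q * ((j - J + x q) * (j - J + x q - 1) * (x q + 1) * x q)"
      using entry_term_Suc_q[OF \<open>odd i\<close> q \<open>j < i\<close>, of n] \<open>i < n\<close>
      by (simp only: eqs(1-4) r less_imp_le simp_thms)
    then have t: "entry_term i j n (Suc q) * ((J - x (Suc q)) * (w - x (Suc q))) * \<kappa> q
        = entry_term i j n q * ((j - J + x q) * (j - J + x q - 1)) * ((x q + 1) * x q)"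
      by (simp add: \<kappa>_def mult.assoc)
    have "V (Suc q) * ((J - x (Suc q)) * (w - x (Suc q)) * \<kappa> (Suc q))
        = entry_term i j n (Suc q) * ((J - x (Suc q)) * (w - x (Suc q))) / ((x q + 1) * x q)"
      using p by (simp add: V_def eqs(5))
    also have "\<dots> = entry_term i j n q * ((j - J + x q) * (j - J + x q - 1)) / \<kappa> q"
      using t p by (simp add: frac_eq_eq)
    also have "\<dots> = V q * L q"
      using p by (simp add: V_def L_def)
    finally show ?thesis .
  qed
  have partial: "(\<Sum>q\<le>Q. A * entry_term i j (n + 1) q + B * entry_term i j n q + C * entry_term i j (n - 1) q)
      = V Q * L Q * Z (x Q)" if "2 * Q \<le> j" for Q
    using that
  proof (induction Q)
    case 0
    show ?case
      using summand[of 0] by (simp add: x_def)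
  next
    case (Suc Q)
    have "(\<Sum>q\<le>Suc Q. A * entry_term i j (n + 1) q + B * entry_term i j n q + C * entry_term i j (n - 1) q)
        = V Q * L Q * Z (x Q) + V (Suc Q) * (L (Suc Q) * Z (x (Suc Q))
            - (J - x (Suc Q)) * (w - x (Suc Q)) * \<kappa> (Suc Q) * Z (x (Suc Q) + 2))"
      using Suc summand[of "Suc Q"] by simp
    also have "\<dots> = V Q * L Q * Z (x Q) + V (Suc Q) * L (Suc Q) * Z (x (Suc Q))
        - (V (Suc Q) * ((J - x (Suc Q)) * (w - x (Suc Q)) * \<kappa> (Suc Q))) * Z (x (Suc Q) + 2)"
      by (simp add: algebra_simps)
    also have "\<dots> = V (Suc Q) * L (Suc Q) * Z (x (Suc Q))"
      using Suc.prems by (subst shift) (simp_all add: eqs(5))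
    finally show ?case .
  qed
  have "L (j div 2) = 0"
  proof -
    have "j = 2 * (j div 2) \<or> j = 2 * (j div 2) + 1"
      by presburger
    then have "real j = 2 * real (j div 2) \<or> real j = 2 * real (j div 2) + 1"
      by (metis of_nat_add of_nat_mult of_nat_numeral of_nat_1)
    then show ?thesis
      by (auto simp: L_def x_def)
  qed
  then show ?thesis
    using partial[of "j div 2"] by (simp add: sum.distrib sum_distrib_left)
qed

section \<open>Matrix entries as hypergeometric sums\<close>

lemma pochhammer_uminus_of_nat:
  assumes "k \<le> n"
  shows "pochhammer (- real n) k = (-1) ^ k * (fact n / fact (n - k))"
  using pochhammer_minus[of "real n" k] pochhammer_Suc_of_nat[of "n - k" k] assms
  by (simp add: of_nat_diff)

text \<open>
  Rewriting the Pochhammer symbols as factorials isolates \<open>(fact k)\<^sup>2\<close> in the denominator, which is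
  exactly what the numerator of the Legendre moment cancels.
\<close>
lemma d_coeff_eq:
  assumes "k \<le> n" "p \<le> n"
  shows "d_coeff p n k = (-1) ^ (n + k + p) * sqrt (2 * (real n - real p) + 1)
    * (fact (n - p + k) / (fact (n - k) * (fact k)\<^sup>2))
    * falling_by_two (real n + real k + 1) ((p + 1) div 2)
    * falling_by_two (real n - real k - 1) ((p - 1) div 2)"
proof -
  have s: "(-1 :: real) ^ n * (x / ((-1) ^ p * y)) = (-1) ^ (n + p) * (x / y)" for x y
    by (cases "even p") (auto simp: power_add)
  have q: "pochhammer (real n - real p + 1) k = fact (n - p + k) / fact (n - p)"
    using pochhammer_Suc_of_nat[of "n - p" k] assms by (simp add: of_nat_diff)
  have "sqrt (2 * real n - 2 * real p + 1) = sqrt (2 * (real n - real p) + 1)"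
    by (simp add: algebra_simps)
  then show ?thesis
    unfolding d_coeff_def pochhammer_uminus_of_nat[OF assms(1)] pochhammer_uminus_of_nat[OF assms(2)] q
      falling_by_two_def s pochhammer_fact[symmetric]
    by (simp add: power_add power2_eq_square)
qed

text \<open>
  One of the factors \<open>r - 1, r - 3, \<dots>\<close> is zero.  With \<open>r\<close> the offset \<open>N - k\<close> of a power \<open>t ^ k\<close>, this
  removes all powers of odd offset below \<open>p\<close> from the entry.
\<close>
lemma falling_by_two_eq_0:
  assumes "odd r" "odd p" "r < p"
  shows "falling_by_two (real r - 1) ((p - 1) div 2) = 0"
proof -
  obtain l where l: "r = 2 * l + 1"
    using assms(1) by (rule oddE)
  have "l < (p - 1) div 2"
    using assms by (auto simp: l elim!: oddE)
  then show ?thesis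
    by (auto simp: falling_by_two_def l intro!: bexI[of _ l])
qed

text \<open>
  The moment vanishes below the column index \<open>N - j\<close>, so only offsets \<open>N - k \<le> j < p\<close> matter; the
  odd ones among them vanish by the preceding lemma.  In the remaining terms the signs combine
  to \<open>-1\<close>.  The square roots depend on \<open>N\<close> but not on the summation index.
\<close>
lemma D1_entry_eq:
  assumes "odd p" "j < p" "p \<le> N"
  shows "D1 N $$ (N - p, N - j)
    = - sqrt 2 * (sqrt (2 * (real N - real p) + 1) * sqrt (2 * (real N - real j) + 1))
      * (\<Sum>q\<le>j div 2. entry_term p j N q)"
proof -
  define s where "s = N - j"
  have s: "real s = real N - real j" "s \<le> N" "N - s = j"
    using assms by (auto simp: s_def)
  define r where "r = sqrt 2 * (sqrt (2 * (real N - real p) + 1) * sqrt (2 * (real N - real j) + 1))"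
  have h: "h_fun N (N - p) t = (\<Sum>k=0..N. d_coeff p N k * t ^ k)" for t
  proof -
    have "N - (N - p) = p"
      using assms by simp
    then show ?thesis
      unfolding h_fun_def Let_def using \<open>odd p\<close> by presburger
  qed
  have "D1 N $$ (N - p, s) = 2 * integral {0..1}
      (\<lambda>t. \<Sum>k=0..N. d_coeff p N k * (t ^ k * poly (legendre_hat s) (2 * t - 1)))"
    using assms by (simp add: D1_def s_def h sum_distrib_right mult.assoc)
  also have "\<dots> = 2 * (\<Sum>k=0..N. d_coeff p N k * legendre_moment s k)"
    unfolding legendre_moment_def
    by (subst integral_sum) (auto intro!: integrable_continuous_real continuous_intros)
  also have "(\<Sum>k=0..N. d_coeff p N k * legendre_moment s k)
      = (\<Sum>k\<in>(\<lambda>q. N - 2 * q) ` {..j div 2}. d_coeff p N k * legendre_moment s k)"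
  proof (rule sum.mono_neutral_right)
    show "\<forall>k\<in>{0..N} - (\<lambda>q. N - 2 * q) ` {..j div 2}. d_coeff p N k * legendre_moment s k = 0"
    proof
      fix k assume k: "k \<in> {0..N} - (\<lambda>q. N - 2 * q) ` {..j div 2}"
      show "d_coeff p N k * legendre_moment s k = 0"
      proof (cases "s \<le> k")
        case True
        then have "N - k \<le> j"
          using s by linarith
        moreover have "odd (N - k)"
        proof
          assume "even (N - k)"
          then obtain q where "N - k = 2 * q"
            by (rule evenE)
          then have "k = N - 2 * q" "q \<le> j div 2"
            using k \<open>N - k \<le> j\<close> by auto
          then show False
            using k by auto
        qed
        ultimately have "falling_by_two (real (N - k) - 1) ((p - 1) div 2) = 0"
          using assms by (intro falling_by_two_eq_0) auto
        then show ?thesis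
          using k assms by (simp add: d_coeff_eq of_nat_diff)
      qed (simp add: legendre_moment_eq_0)
    qed
  qed auto
  also have "\<dots> = (\<Sum>q\<le>j div 2. d_coeff p N (N - 2 * q) * legendre_moment s (N - 2 * q))"
    using assms by (subst sum.reindex) (auto simp: inj_on_def)
  also have "\<dots> = (\<Sum>q\<le>j div 2. - r / 2 * entry_term p j N q)"
  proof (rule sum.cong[OF refl])
    fix q assume "q \<in> {..j div 2}"
    then have q: "2 * q \<le> j" by auto
    define k where "k = N - 2 * q"
    have k: "k \<le> N" "s \<le> k" "N - k = 2 * q" "k - s = j - 2 * q" "real k = real N - 2 * real q"
      using q assms by (auto simp: k_def s_def)
    have sign: "(-1 :: real) ^ (N + k + p) = - 1"
      using \<open>odd p\<close> q assms by (auto simp: k_def)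
    have idx: "N - p + k = 2 * N - p - 2 * q" "k + s + 1 = 2 * N - 2 * q - j + 1"
      using q assms by (auto simp: k_def s_def)
    have rt: "sqrt ((2 * real s + 1) / 2) = sqrt 2 * sqrt (2 * (real N - real j) + 1) / 2"
      by (simp add: s real_sqrt_divide real_div_sqrt divide_simps)
    have arg: "real N + real k + 1 = 2 * real N - 2 * real q + 1" "real N - real k - 1 = 2 * real q - 1"
      by (simp_all add: k)
    show "d_coeff p N (N - 2 * q) * legendre_moment s (N - 2 * q) = - r / 2 * entry_term p j N q"
      unfolding k_def[symmetric] d_coeff_eq[OF k(1) assms(3)] legendre_moment_eq[OF k(2)] sign arg
        idx k(3,4) rt entry_term_def r_def
      by (simp add: power2_eq_square mult_ac del: fact_Suc)
  qed
  also have "2 * \<dots> = - r * (\<Sum>q\<le>j div 2. entry_term p j N q)"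
    by (simp add: sum_distrib_left)
  finally show ?thesis
    by (simp add: s_def r_def)
qed

section \<open>The three-term recurrence\<close>

text \<open>
  The coefficients of the theorem, written in \<open>J\<close> and \<open>w\<close>, are those of the recurrence divided by its
  leading coefficient.  Replacing the linear factors by variables first keeps the clearing of
  denominators small.
\<close>
lemma middle_coefficient_eq:
  fixes J w j :: real
  assumes "J > 0" "w > 0"
  shows "(w + 1) / (J + 2) * ((- j / 2 * ((j - (J - w) + 1) / 2) * ((J + w + 3) / 2)
        - (- w / 2) * (- (J + 1) / 2) * (- (J + 2) / 2) * (- J / 2) / ((J + w + 1) / 2))
        * (((J + w + 5) / 2) / ((J + 3) / 2 * ((w + 2) / 2) * ((w + 1) / 2) * ((w + 3) / 2))) - 1)
      = (j * (J - w - j - 1) * (J + w + 1) * (J + w + 3) * (J + w + 5)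
          - w * J * (J + 1) * (J + 2) * (J + w + 5)
          - (J + 3) * (w + 1) * (w + 2) * (w + 3) * (J + w + 1))
        / ((J + 2) * (J + 3) * (w + 2) * (w + 3) * (J + w + 1))"
proof -
  define E where "E = (J + 3) * (w + 2) * (w + 3)"
  define P where "P = J + w + 1"
  define R where "R = J + w + 5"
  define Y where "Y = w * J * (J + 1) * (J + 2)"
  define X where "X = j * (J - w - j - 1) * (J + w + 3)"
  have ne: "J + 2 \<noteq> 0" "w + 1 \<noteq> 0" "P \<noteq> 0" "E \<noteq> 0"
    using assms by (auto simp: E_def P_def)
  have clear: "u / v * ((X / 8 - Y / (8 * P)) * (8 * R / (E * u)) - 1)
      = (X * P * R - Y * R - E * u * P) / (v * E * P)"
    if "u \<noteq> 0" "v \<noteq> 0" for u v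
    using that ne(3,4) by (simp add: field_simps)
  have 1: "- j / 2 * ((j - (J - w) + 1) / 2) * ((J + w + 3) / 2) = X / 8"
    by (simp add: X_def field_simps)
  have 2: "(- w / 2) * (- (J + 1) / 2) * (- (J + 2) / 2) * (- J / 2) / ((J + w + 1) / 2) = Y / (8 * P)"
  proof -
    have "(- w / 2) * (- (J + 1) / 2) * (- (J + 2) / 2) * (- J / 2) = Y / 16"
      unfolding Y_def by (simp add: field_simps)
    then show ?thesis
      by (simp add: P_def)
  qed
  have 3: "((J + w + 5) / 2) / ((J + 3) / 2 * ((w + 2) / 2) * ((w + 1) / 2) * ((w + 3) / 2))
      = 8 * R / (E * (w + 1))"
    unfolding R_def[symmetric] E_def by (simp add: mult_ac)
  show ?thesis
    unfolding 1 2 3 clear[OF ne(2,1)]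
    by (simp add: X_def Y_def P_def R_def E_def mult_ac)
qed

lemma lower_coefficient_eq:
  fixes J w :: real
  assumes "J > 0" "w > 0"
  shows "(w - 1) * (w + 1) / (J * (J + 2)) * (((- w / 2) * (- (J + 1) / 2) * (- (J + 2) / 2) * (- J / 2)
          * ((J + w + 5) / 2))
        / ((J + w + 1) / 2 * ((J + 3) / 2) * ((w + 2) / 2) * ((w + 1) / 2) * ((w + 3) / 2)))
      = ((w - 1) * w * (J + 1) * (J + 2) * (J + w + 5))
        / ((J + 2) * (J + 3) * (w + 2) * (w + 3) * (J + w + 1))"
proof -
  have ne: "J \<noteq> 0" "J + 2 \<noteq> 0" "w + 1 \<noteq> 0"
    using assms by auto
  have cancel: "v * u / (J * z) * (((- w / 2) * (- a / 2) * (- z / 2) * (- J / 2) * (R / 2))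
        / (P / 2 * (b / 2) * (c / 2) * (u / 2) * (d / 2))) = v * w * a * z * R / (z * b * c * d * P)"
    if "u \<noteq> 0" "z \<noteq> 0" for u v z a b c d P R :: real
    using that ne(1) by simp
  show ?thesis
    by (rule cancel) (use ne in auto)
qed

theorem theorem20:
  fixes n i j :: nat
    and a b c d e f g h l k1 k2 :: real
  assumes "odd i" and "j < i" and "i < n"
    and "a = real n + (3 - real j) / 2"
    and "b = - real n + (real i + real j) / 2"
    and "c = - real j / 2"
    and "d = (real j - real i + 1) / 2"
    and "e = 1"
    and "f = 1 / 2"
    and "g = 3 / 2"
    and "h = sqrt (2 * (real n - real i) + 3) * sqrt (2 * (real n - real j) + 3)
               * (2 * real n - real i - real j + 1)
             / (sqrt (2 * (real n - real i) + 1) * sqrt (2 * (real n - real j) + 1)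
               * (2 * real n - real j + 2))"
    and "l = sqrt (2 * (real n - real i) + 3) * sqrt (2 * (real n - real j) + 3)
               * (2 * real n - real i - real j - 1) * (2 * real n - real i - real j + 1)
             / (sqrt (2 * (real n - real i) - 1) * sqrt (2 * (real n - real j) - 1)
               * (2 * real n - real j) * (2 * real n - real j + 2))"
    and "k1 = h * ((c * d * (a - b) - b * (e - a) * (f - a) * (g - a) / (a - b - 1))
                   * ((1 + a - b) / (a * (e - b) * (f - b) * (g - b))) - 1)"
    and "k2 = l * ((b * (e - a) * (f - a) * (g - a) * (1 + a - b))
                   / ((a - b - 1) * a * (e - b) * (f - b) * (g - b)))"
  shows "D1 (n + 1) $$ (n - i + 1, n - j + 1)
         + k1 * D1 n $$ (n - i, n - j)
         + k2 * D1 (n - 1) $$ (n - i - 1, n - j - 1) = 0"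
proof -
  define J where "J = 2 * real n - real j"
  define w where "w = 2 * real n - real j - real i"
  define A where "A = (J + 2) * (J + 3) * (w + 2) * (w + 3) * (J + w + 1)"
  define B where "B = real j * (real i - real j - 1) * (J + w + 1) * (J + w + 3) * (J + w + 5)
             - w * J * (J + 1) * (J + 2) * (J + w + 5)
             - (J + 3) * (w + 1) * (w + 2) * (w + 3) * (J + w + 1)"
  define C where "C = (w - 1) * w * (J + 1) * (J + 2) * (J + w + 5)"
  define S where "S N = (\<Sum>q\<le>j div 2. entry_term i j N q)" for N
  have rec: "A * S (n + 1) + B * S n + C * S (n - 1) = 0"
    unfolding S_def A_def B_def C_def J_def w_def
    by (rule sum_entry_term_recurrence[OF assms(1-3)])
  have pos: "J > 0" "w > 0" "A > 0"
    using assms(1-3) by (auto simp: J_def w_def A_def)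
  have iw: "real i = J - w"
    by (simp add: J_def w_def)
  \<comment> \<open>The square-root factors of the three entries are \<open>\<sigma> 3\<close>, \<open>\<sigma> 1\<close> and \<open>\<sigma> (- 1)\<close>; the quotients of
    square roots in \<open>h\<close> and \<open>l\<close> convert the last two into the first.\<close>
  define \<sigma> where "\<sigma> x = sqrt (2 * (real n - real i) + x) * sqrt (2 * (real n - real j) + x)" for x
  have \<sigma>_pos: "\<sigma> 1 > 0" "\<sigma> (- 1) > 0"
    using assms(2,3) by (auto simp: \<sigma>_def)
  have D_up: "D1 (n + 1) $$ (n - i + 1, n - j + 1) = - sqrt 2 * \<sigma> 3 * S (n + 1)"
  proof -
    have "n - i + 1 = n + 1 - i" "n - j + 1 = n + 1 - j"
      using assms(2,3) by auto
    moreover have "2 * (real (n + 1) - real x) + 1 = 2 * (real n - real x) + 3" for x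
      by simp
    ultimately show ?thesis
      using D1_entry_eq[of i j "n + 1"] assms(1-3) by (simp only: \<sigma>_def S_def) simp
  qed
  have D_mid: "D1 n $$ (n - i, n - j) = - sqrt 2 * \<sigma> 1 * S n"
    using D1_entry_eq[of i j n] assms(1-3) by (simp add: \<sigma>_def S_def)
  have D_down: "D1 (n - 1) $$ (n - i - 1, n - j - 1) = - sqrt 2 * \<sigma> (- 1) * S (n - 1)"
  proof -
    have "n - i - 1 = n - 1 - i" "n - j - 1 = n - 1 - j"
      by auto
    moreover have "2 * (real (n - 1) - real x) + 1 = 2 * (real n - real x) + - 1" for x
      using assms(3) by (simp add: of_nat_diff)
    ultimately show ?thesis
      using D1_entry_eq[of i j "n - 1"] assms(1-3) by (simp only: \<sigma>_def S_def) simp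
  qed
  have params: "a = (J + 3) / 2" "b = - w / 2" "c = - real j / 2" "d = (real j - (J - w) + 1) / 2"
    using assms(4-7) by (auto simp: J_def w_def field_simps)
  have diffs: "e - a = - (J + 1) / 2" "f - a = - (J + 2) / 2" "g - a = - J / 2"
    "e - b = (w + 2) / 2" "f - b = (w + 1) / 2" "g - b = (w + 3) / 2"
    "a - b = (J + w + 3) / 2" "a - b - 1 = (J + w + 1) / 2" "1 + a - b = (J + w + 5) / 2"
    unfolding params assms(8-10) by (simp_all add: field_simps)
  have h: "h = \<sigma> 3 / \<sigma> 1 * ((w + 1) / (J + 2))"
    unfolding assms(11) by (simp add: \<sigma>_def J_def w_def algebra_simps)
  have "(w + 1) / (J + 2) * ((c * d * (a - b) - b * (e - a) * (f - a) * (g - a) / (a - b - 1))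
      * ((1 + a - b) / (a * (e - b) * (f - b) * (g - b))) - 1) = B / A"
    unfolding diffs(8,9) unfolding diffs(1-7) unfolding params A_def B_def iw by (rule middle_coefficient_eq[OF pos(1,2)])
  then have k1: "k1 = \<sigma> 3 / \<sigma> 1 * (B / A)"
    unfolding assms(13) h by (simp only: mult.assoc)
  have l: "l = \<sigma> 3 / \<sigma> (- 1) * ((w - 1) * (w + 1) / (J * (J + 2)))"
    unfolding assms(12) by (simp add: \<sigma>_def J_def w_def algebra_simps)
  have "(w - 1) * (w + 1) / (J * (J + 2)) * ((b * (e - a) * (f - a) * (g - a) * (1 + a - b))
      / ((a - b - 1) * a * (e - b) * (f - b) * (g - b))) = C / A"
    unfolding diffs(8,9) unfolding diffs(1-7) unfolding params A_def C_def by (rule lower_coefficient_eq[OF pos(1,2)])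
  then have k2: "k2 = \<sigma> 3 / \<sigma> (- 1) * (C / A)"
    unfolding assms(14) l by (simp only: mult.assoc)
  have "D1 (n + 1) $$ (n - i + 1, n - j + 1) + k1 * D1 n $$ (n - i, n - j)
      + k2 * D1 (n - 1) $$ (n - i - 1, n - j - 1)
      = - sqrt 2 * \<sigma> 3 / A * (A * S (n + 1) + B * S n + C * S (n - 1))"
    unfolding D_up D_mid D_down k1 k2 using pos \<sigma>_pos by (simp add: field_simps)
  then show ?thesis
    unfolding rec by simp
qed

end
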